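(* Let $q \in \mathbb{N}$ with $q \geq 2$, let $S = \{1,\dots,|S|\}$ be a finite set, and let $f_s : \mathbb{R}^n \to \mathbb{R}$, $s \in S$, be $(q+1)$-times continuously differentiable functions. Let $f : \mathbb{R}^n \to \mathbb{R}$, $f(x) = \max_{s \in S} f_s(x)$, and let $x^* \in \mathbb{R}^n$. Assume that (i) $f$ grows with order $2$ around $x^*$, i.e., there are an open neighborhood $V \subseteq \mathbb{R}^n$ of $x^*$ and a constant $\beta > 0$ with $f(x) \geq f(x^* ) + \beta \| x - x^* \|^2$ for all $x \in V$; (ii) $A(x^* ) = S$ and there is $\lambda^* \in \mathbb{R}^{|S|}$ with $\lambda^*_s > 0$ for all $s \in S$, $\sum_{s \in S} \lambda^*_s = 1$, and $\sum_{s \in S} \lambda^*_s \nabla f_s(x^* ) = 0$; (iii) the vectors $\nabla f_s(x^* )$, $s \in S$, are affinely independent. Then property (P) holds for $p = 2$ and $x^*$: there are an open neighborhood $U \subseteq \mathbb{R}^n$ of $x^*$ and a constant $C > 0$ such that $\Lambda^2(x,\Delta) \geq C$ for all $x \in U$ and all $\Delta > 0$ with $x^* \notin \bar{B}_\Delta(x)$.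
   Context: Notation: $\|\cdot\|$ is the Euclidean norm, $\bar{B}_\Delta(x) = \{ y \in \mathbb{R}^n : \| y - x \| \leq \Delta \}$. The active set at $x$ is $A(x) = \{ s \in S : f_s(x) = f(x) \}$. For $x \in \mathbb{R}^n$, $\Delta > 0$, $p \in \mathbb{N}$: $\Lambda^p(x,\Delta) = \dfrac{f(x) - f(z^*(x,\Delta))}{\Delta^p}$, where $z^*(x,\Delta) \in \arg\min_{z \in \bar{B}_\Delta(x)} f(z)$. *)

theory Defs
  imports "HOL-Analysis.Analysis"
begin

text \<open>
  \<open>k\<close>-times continuous differentiability on the whole space: the derivative of order \<open>k + 1\<close> is
  reached through the directional derivatives \<open>x \<mapsto> Df(x) v\<close>, for all directions \<open>v\<close>. In finite
  dimension this is the usual notion (all partial derivatives up to order \<open>k\<close> exist and are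
  continuous).
\<close>

fun k_times_cont_diff :: "nat \<Rightarrow> ('a::euclidean_space \<Rightarrow> real) \<Rightarrow> bool" where
  "k_times_cont_diff 0 f \<longleftrightarrow> continuous_on UNIV f"
| "k_times_cont_diff (Suc k) f \<longleftrightarrow>
     (\<forall>x. f differentiable at x) \<and>
     (\<forall>v. k_times_cont_diff k (\<lambda>x. frechet_derivative f (at x) v))"

definition gradient :: "('a::euclidean_space \<Rightarrow> real) \<Rightarrow> 'a \<Rightarrow> 'a" where
  "gradient f x = (THE D. GDERIV f x :> D)"

definition active_set :: "'s set \<Rightarrow> ('s \<Rightarrow> 'a \<Rightarrow> real) \<Rightarrow> ('a \<Rightarrow> real) \<Rightarrow> 'a \<Rightarrow> 's set" where
  "active_set S fs f x = {s \<in> S. fs s x = f x}"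

text \<open>
  \<^const>\<open>affine_dependent\<close> is a property of sets; for an indexed family, repeated vectors have to be
  excluded as well.
\<close>

definition affinely_independent_family :: "'s set \<Rightarrow> ('s \<Rightarrow> 'a::real_vector) \<Rightarrow> bool" where
  "affinely_independent_family S v \<longleftrightarrow> inj_on v S \<and> \<not> affine_dependent (v ` S)"

definition grows_with_order :: "nat \<Rightarrow> ('a::euclidean_space \<Rightarrow> real) \<Rightarrow> 'a \<Rightarrow> bool" where
  "grows_with_order p f xs \<longleftrightarrow>
     (\<exists>V \<beta>. open V \<and> xs \<in> V \<and> \<beta> > 0 \<and> (\<forall>x\<in>V. f x \<ge> f xs + \<beta> * norm (x - xs) ^ p))"

text \<open>
  The point \<^term>\<open>arg_min_on f (cball x \<Delta>)\<close> is a fixed choice of a minimizer of \<open>f\<close> on the closed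
  ball; the value below does not depend on that choice (lemma \<open>Lambda_eq\<close>).
\<close>

definition Lambda ::
    "('a::euclidean_space \<Rightarrow> real) \<Rightarrow> nat \<Rightarrow> 'a \<Rightarrow> real \<Rightarrow> real" where
  "Lambda f p x \<Delta> = (f x - f (arg_min_on f (cball x \<Delta>))) / \<Delta> ^ p"

lemma Lambda_eq:
  assumes "z \<in> cball x \<Delta>" "\<And>y. y \<in> cball x \<Delta> \<Longrightarrow> f z \<le> f y"
  shows "Lambda f p x \<Delta> = (f x - f z) / \<Delta> ^ p"
proof -
  have "is_arg_min f (\<lambda>y. y \<in> cball x \<Delta>) (arg_min_on f (cball x \<Delta>))"
    unfolding arg_min_on_def arg_min_def
    by (rule someI[of _ z]) (use assms in \<open>auto simp: is_arg_min_linorder\<close>)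
  then have "f (arg_min_on f (cball x \<Delta>)) = f z"
    using assms unfolding is_arg_min_linorder by (meson order_antisym)
  then show ?thesis
    by (simp add: Lambda_def)
qed

definition property_P :: "('a::euclidean_space \<Rightarrow> real) \<Rightarrow> nat \<Rightarrow> 'a \<Rightarrow> bool" where
  "property_P f p xs \<longleftrightarrow>
     (\<exists>U C. open U \<and> xs \<in> U \<and> C > 0 \<and>
        (\<forall>x\<in>U. \<forall>\<Delta>>0. xs \<notin> cball x \<Delta> \<longrightarrow> Lambda f p x \<Delta> \<ge> C))"

end

theory Submission
  imports Defs
begin

text \<open>
  Move \<open>x\<^sup>*\<close> to the origin and subtract \<open>f x\<^sup>*\<close>, so that every piece \<open>f\<^sub>s\<close> vanishes at \<open>0\<close>; let
  \<open>g\<^sub>s\<close> be its gradient there and \<open>\<lambda>\<close> the multipliers. Near \<open>0\<close> one has to find, for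
  \<open>0 < \<Delta> < \<parallel>x\<parallel>\<close>, a step of length at most \<open>\<Delta>\<close> along which \<^emph>\<open>every\<close> piece falls below
  \<open>f x - C \<Delta>\<^sup>2\<close>. As \<open>\<Delta> < \<parallel>x\<parallel>\<close>, a decrease of order \<open>\<Delta> \<parallel>x\<parallel>\<close> is enough. Two situations occur.

  If \<open>f x\<close> is large compared with \<open>\<parallel>x\<parallel>\<^sup>2\<close>, walking straight to the origin works: each \<open>f\<^sub>s\<close> moves
  towards \<open>f\<^sub>s 0 = 0\<close> linearly up to an error of order \<open>\<parallel>x\<parallel>\<^sup>2\<close>, which the value \<open>f x\<close>
  dominates (\<open>descent_at_high_value\<close>).

  If \<open>f x = O(\<parallel>x\<parallel>\<^sup>2)\<close>, then all slopes \<open>g\<^sub>s \<bullet> x\<close> are \<open>O(\<parallel>x\<parallel>\<^sup>2)\<close>: they are bounded above by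
  the values, and below because their \<open>\<lambda>\<close>-mean is zero (\<open>abs_le_of_weighted_sum_zero\<close>). The pieces may
  change at different rates along the ray to the origin, but affine independence lets a correction
  \<open>v\<close> prescribe all products \<open>g\<^sub>s \<bullet> v\<close> up to their \<open>\<lambda>\<close>-mean, at the cost \<open>\<parallel>v\<parallel> = O(\<parallel>x\<parallel>\<^sup>2)\<close>
  (\<open>exists_small_solution\<close>). Along the step \<open>v - x\<close> all pieces then have the same slope
  \<open>- (\<Sum>s. \<lambda>\<^sub>s \<nabla>f\<^sub>s(x) \<bullet> x)\<close> up to a small multiple of \<open>\<parallel>x\<parallel>\<^sup>2\<close>
  (\<open>descent_along_corrected_ray\<close>). It remains to bound this mean from below. By
  Taylor's formula (\<open>second_order_error\<close>) and \<open>\<Sum>s. \<lambda>\<^sub>s g\<^sub>s = 0\<close> it equals, up to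
  \<open>o(\<parallel>x\<parallel>\<^sup>2)\<close>, twice the mean of the values \<open>f\<^sub>s x\<close>. The same kind of correction, now chosen
  to make all values equal, leads to a point at distance \<open>O(\<parallel>x\<parallel>\<^sup>2)\<close> from \<open>x\<close> where \<open>f\<close> is close to that
  mean, so quadratic growth gives the mean the order \<open>\<parallel>x\<parallel>\<^sup>2\<close> (\<open>growth_of_weighted_mean\<close>).
\<close>

section \<open>Linear systems for affinely independent gradients\<close>

text \<open>
  The obstruction \<open>\<Sum>s. lam s * a s = 0\<close> is the only one, because affine independence of the \<open>g s\<close>
  says that the vectors \<open>(g s, 1)\<close> are linearly independent. The part of \<open>(g s, 1)\<close>
  orthogonal to the others separates \<open>g s\<close> from them by an affine function; a combination of these
  separating directions solves the system, with coefficients \<open>a s\<close>, hence the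
  bound on its norm.
\<close>

lemma exists_small_solution:
  fixes g :: "'s \<Rightarrow> 'a::euclidean_space"
  assumes "finite S" and lam: "sum lam S = 1" "(\<Sum>s\<in>S. lam s *\<^sub>R g s) = 0"
    and indep: "affinely_independent_family S g"
  obtains K where "K > 0"
    and "\<And>a M. \<lbrakk>(\<Sum>s\<in>S. lam s * a s) = 0; \<And>s. s \<in> S \<Longrightarrow> \<bar>a s\<bar> \<le> M\<rbrakk>
           \<Longrightarrow> \<exists>v. norm v \<le> K * M \<and> (\<forall>s\<in>S. v \<bullet> g s = a s)"
proof -
  have inj: "inj_on g S" and aff: "\<not> affine_dependent (g ` S)"
    using indep by (auto simp: affinely_independent_family_def)
  \<comment> \<open>Dual directions; subtracting \<open>lam s\<close> makes the right-hand side have \<open>lam\<close>-mean zero in \<open>r\<close>.\<close>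
  have "\<exists>v. \<forall>r\<in>S. v \<bullet> g r = (if r = s then 1 else 0) - lam s" if s: "s \<in> S" for s
  proof -
    define X where "X = (\<lambda>x. (x, 1::real)) ` (g ` S - {g s})"
    have "finite X"
      using \<open>finite S\<close> by (simp add: X_def)
    have not_span: "(g s, 1) \<notin> span X"
    proof
      assume "(g s, 1) \<in> span X"
      then obtain u where u: "(g s, 1) = (\<Sum>v\<in>X. u v *\<^sub>R v)"
        using span_finite[OF \<open>finite X\<close>] by auto
      have "(\<Sum>v\<in>X. u v *\<^sub>R v) = (\<Sum>y\<in>g ` S - {g s}. u (y, 1) *\<^sub>R (y, 1::real))"
        unfolding X_def by (subst sum.reindex) (auto simp: inj_on_def)
      with u have "g s = (\<Sum>y\<in>g ` S - {g s}. u (y, 1) *\<^sub>R y)"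
        and "1 = (\<Sum>y\<in>g ` S - {g s}. u (y, 1))"
        by (auto simp: prod_eq_iff fst_sum snd_sum)
      then have "g s \<in> affine hull (g ` S - {g s})"
        using \<open>finite S\<close> by (subst affine_hull_finite) (auto intro!: exI[of _ "\<lambda>y. u (y, 1)"])
      with aff s show False
        unfolding affine_dependent_def by blast
    qed
    obtain y z where y: "y \<in> span X" and z: "\<And>w. w \<in> span X \<Longrightarrow> orthogonal z w"
      and yz: "(g s, 1::real) = y + z"
      using orthogonal_subspace_decomp_exists by blast
    have "z \<noteq> 0"
      using y yz not_span by auto
    obtain z1 z2 where z12: "z = (z1, z2)"
      by (cases z)
    \<comment> \<open>\<open>x \<mapsto> v \<bullet> x - c\<close> is \<open>1\<close> at \<open>g s\<close> and \<open>0\<close> at the other \<open>g r\<close>; taking \<open>lam\<close>-means gives \<open>c = - lam s\<close>.\<close>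
    define v where "v = z1 /\<^sub>R (z \<bullet> z)"
    define c where "c = - z2 / (z \<bullet> z)"
    have val: "v \<bullet> x = (z \<bullet> (x, 1)) / (z \<bullet> z) + c" for x
      by (simp add: v_def c_def z12 divide_inverse algebra_simps)
    have "z \<bullet> (g s, 1) = z \<bullet> z"
      using z[OF y] by (simp add: yz inner_add_right orthogonal_def)
    then have vs: "v \<bullet> g s = 1 + c"
      using \<open>z \<noteq> 0\<close> by (simp add: val)
    have vr: "v \<bullet> g r = c" if "r \<in> S" "r \<noteq> s" for r
    proof -
      have "(g r, 1) \<in> X"
        using that s inj by (auto simp: X_def inj_on_def)
      then have "z \<bullet> (g r, 1) = 0"
        using z[OF span_base] by (auto simp: orthogonal_def)
      then show ?thesis
        by (simp add: val)
    qed
    have "0 = v \<bullet> (\<Sum>r\<in>S. lam r *\<^sub>R g r)"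
      by (simp add: lam)
    also have "\<dots> = (\<Sum>r\<in>S. lam r * (v \<bullet> g r))"
      by (simp add: inner_sum_right)
    also have "\<dots> = (\<Sum>r\<in>S. c * lam r + (if r = s then lam r else 0))"
      by (rule sum.cong) (auto simp: vs vr algebra_simps)
    also have "\<dots> = c + lam s"
      using \<open>finite S\<close> s lam(1) by (simp add: sum.distrib sum_distrib_left[symmetric])
    finally have "c = - lam s"
      by simp
    then show ?thesis
      using vs vr by (intro exI[of _ v]) auto
  qed
  then obtain w where w: "\<And>r s. \<lbrakk>r \<in> S; s \<in> S\<rbrakk> \<Longrightarrow> w s \<bullet> g r = (if r = s then 1 else 0) - lam s"
    by metis
  define K where "K = 1 + (\<Sum>s\<in>S. norm (w s))"
  show thesis
  proof (rule that)
    show "K > 0"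
      unfolding K_def by (simp add: add_pos_nonneg sum_nonneg)
    fix a :: "'s \<Rightarrow> real" and M
    assume a0: "(\<Sum>s\<in>S. lam s * a s) = 0" and aM: "\<And>s. s \<in> S \<Longrightarrow> \<bar>a s\<bar> \<le> M"
    define v where "v = (\<Sum>s\<in>S. a s *\<^sub>R w s)"
    have "S \<noteq> {}"
      using lam by auto
    then have "0 \<le> M"
      using aM by fastforce
    have "norm v \<le> (\<Sum>s\<in>S. M * norm (w s))"
      unfolding v_def by (rule sum_norm_le) (simp add: aM mult_right_mono)
    also have "\<dots> \<le> K * M"
      using \<open>0 \<le> M\<close> by (simp add: K_def sum_distrib_left[symmetric] algebra_simps)
    finally have "norm v \<le> K * M" .
    moreover have "v \<bullet> g r = a r" if "r \<in> S" for r
    proof -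
      have "v \<bullet> g r = (\<Sum>s\<in>S. (if s = r then a s else 0) - lam s * a s)"
        unfolding v_def inner_sum_left
        by (rule sum.cong) (auto simp: w that algebra_simps)
      then show ?thesis
        using \<open>finite S\<close> that a0 by (simp add: sum_subtractf)
    qed
    ultimately show "\<exists>v. norm v \<le> K * M \<and> (\<forall>s\<in>S. v \<bullet> g s = a s)"
      by blast
  qed
qed

text \<open>
  One very negative \<open>b s\<close> would have to be balanced by the others, which are at most \<open>M\<close>.
\<close>

lemma abs_le_of_weighted_sum_zero:
  fixes lam b :: "'s \<Rightarrow> real"
  assumes "finite S" and pos: "\<And>s. s \<in> S \<Longrightarrow> lam s > 0" and lam: "sum lam S = 1"
    and b: "(\<Sum>s\<in>S. lam s * b s) = 0" "\<And>s. s \<in> S \<Longrightarrow> b s \<le> M"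
    and s: "s \<in> S" and l: "0 < l" "l \<le> lam s"
  shows "\<bar>b s\<bar> \<le> M / l"
proof -
  have "0 \<le> (\<Sum>r\<in>S. lam r * (M - b r))"
    using pos b(2) by (intro sum_nonneg mult_nonneg_nonneg) (auto simp: less_imp_le)
  also have eq: "(\<Sum>r\<in>S. lam r * (M - b r)) = M"
    using lam b(1) by (simp add: algebra_simps sum_subtractf sum_distrib_left[symmetric])
  finally have "0 \<le> M" .
  have "lam s * (M - b s) \<le> (\<Sum>r\<in>S. lam r * (M - b r))"
    using pos b(2) assms by (intro member_le_sum mult_nonneg_nonneg) (auto simp: less_imp_le)
  then have *: "lam s * (M - b s) \<le> M"
    by (simp add: eq)
  have "l * (M - b s) \<le> lam s * (M - b s)"
    using l b(2)[OF s] by (intro mult_right_mono) auto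
  with * have "M - b s \<le> M / l"
    using l by (simp add: field_simps)
  moreover have "l \<le> 1"
  proof -
    have "lam s \<le> sum lam S"
      using assms by (intro member_le_sum) (auto simp: less_imp_le)
    then show ?thesis using l lam by simp
  qed
  then have "M \<le> M / l"
    using l \<open>0 \<le> M\<close> by (simp add: field_simps mult_left_le)
  ultimately show ?thesis
    using b(2)[OF s] \<open>0 \<le> M\<close> by (auto simp: abs_le_iff)
qed

lemma abs_weighted_mean_le:
  fixes lam b :: "'s \<Rightarrow> real"
  assumes "\<And>s. s \<in> S \<Longrightarrow> 0 \<le> lam s" "sum lam S = 1" "\<And>s. s \<in> S \<Longrightarrow> \<bar>b s\<bar> \<le> M"
  shows "\<bar>\<Sum>s\<in>S. lam s * b s\<bar> \<le> M"
proof -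
  have "\<bar>\<Sum>s\<in>S. lam s * b s\<bar> \<le> (\<Sum>s\<in>S. lam s * M)"
    using assms by (intro sum_abs[THEN order_trans] sum_mono) (auto simp: abs_mult intro: mult_left_mono)
  then show ?thesis
    using assms(2) by (simp add: sum_distrib_right[symmetric])
qed

text \<open>
  Subtracting the mean makes the linear system solvable. If \<open>g s\<close> is the gradient of the \<open>s\<close>-th piece,
  then adding \<open>v\<close> to the argument levels, to first order, pieces that have the values \<open>- b s\<close>: each
  moves to the mean of these values.
\<close>

lemma small_equalizing_correction:
  fixes g :: "'s \<Rightarrow> 'a::euclidean_space"
  assumes pos: "\<And>s. s \<in> S \<Longrightarrow> 0 \<le> lam s" and lam: "sum lam S = 1"
    and solve: "\<And>a M. \<lbrakk>(\<Sum>s\<in>S. lam s * a s) = 0; \<And>s. s \<in> S \<Longrightarrow> \<bar>a s\<bar> \<le> M\<rbrakk>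
           \<Longrightarrow> \<exists>v. norm v \<le> K * M \<and> (\<forall>s\<in>S. v \<bullet> g s = a s)"
    and b: "\<And>s. s \<in> S \<Longrightarrow> \<bar>b s\<bar> \<le> B"
  obtains v where "norm v \<le> 2 * K * B"
    and "\<And>s. s \<in> S \<Longrightarrow> v \<bullet> g s = b s - (\<Sum>r\<in>S. lam r * b r)"
proof -
  define m where "m = (\<Sum>r\<in>S. lam r * b r)"
  have "\<bar>m\<bar> \<le> B"
    unfolding m_def by (rule abs_weighted_mean_le) (use assms in auto)
  moreover have "(\<Sum>s\<in>S. lam s * (b s - m)) = 0"
    by (simp add: right_diff_distrib sum_subtractf sum_distrib_right[symmetric] lam m_def)
  ultimately obtain v where "norm v \<le> K * (2 * B)" "\<forall>s\<in>S. v \<bullet> g s = b s - m"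
    using solve[of "\<lambda>s. b s - m" "2 * B"] b by fastforce
  then show thesis
    by (intro that) (auto simp: m_def mult_ac)
qed

section \<open>Taylor estimates with a gradient that is differentiable at one point\<close>

lemma GDERIV_along_line:
  assumes "GDERIV f (x + t *\<^sub>R p) :> D"
  shows "((\<lambda>t. f (x + t *\<^sub>R p)) has_real_derivative p \<bullet> D) (at t)"
proof -
  have 1: "((\<lambda>t. x + t *\<^sub>R p) has_derivative (\<lambda>h. h *\<^sub>R p)) (at t)"
    by (auto intro!: derivative_eq_intros)
  have "((\<lambda>t. f (x + t *\<^sub>R p)) has_derivative (\<lambda>h. (h *\<^sub>R p) \<bullet> D)) (at t)"
    using has_derivative_compose[OF 1, of f "\<lambda>h. h \<bullet> D"] assms by (simp add: gderiv_def)
  then show ?thesis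
    by (simp add: has_field_derivative_def mult_commute_abs)
qed

lemma GDERIV_mean_value:
  assumes "\<And>y. GDERIV f y :> G y" "0 < (t::real)"
  obtains \<tau> where "0 < \<tau>" "\<tau> < t" "f (x + t *\<^sub>R p) - f x = t * (p \<bullet> G (x + \<tau> *\<^sub>R p))"
proof -
  have "((\<lambda>t. f (x + t *\<^sub>R p)) has_real_derivative p \<bullet> G (x + \<tau> *\<^sub>R p)) (at \<tau>)" for \<tau>
    using assms(1) by (rule GDERIV_along_line)
  from MVT2[OF assms(2) this] that show thesis
    by auto
qed

text \<open>
  The mean value theorem moves the gradient to an intermediate point, whose distance to \<open>0\<close> is at most
  \<open>norm x + norm d\<close>. The slope is compared with the gradient at \<open>0\<close> instead of that at \<open>x\<close>, since the
  corrections \<open>v\<close> are chosen in terms of \<open>G 0\<close>.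
\<close>

lemma first_order_error:
  assumes f: "\<And>y. GDERIV f y :> G y"
    and lip: "\<And>y. norm y < \<rho> \<Longrightarrow> norm (G y - G 0) \<le> L * norm y"
    and small: "norm x + norm d < \<rho>" and "0 \<le> L"
  shows "\<bar>f (x + d) - f x - d \<bullet> G 0\<bar> \<le> L * (norm x + norm d) * norm d"
proof -
  obtain \<tau> where \<tau>: "0 < \<tau>" "\<tau> < 1" "f (x + d) - f x = d \<bullet> G (x + \<tau> *\<^sub>R d)"
    using GDERIV_mean_value[of f G 1 x d] f by auto
  have "norm (x + \<tau> *\<^sub>R d) \<le> norm x + \<tau> * norm d"
    using norm_triangle_ineq[of x "\<tau> *\<^sub>R d"] \<tau> by simp
  also have "\<dots> \<le> norm x + norm d"
    using \<tau> by (simp add: mult_left_le_one_le)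
  finally have le: "norm (x + \<tau> *\<^sub>R d) \<le> norm x + norm d" .
  have "\<bar>f (x + d) - f x - d \<bullet> G 0\<bar> = \<bar>d \<bullet> (G (x + \<tau> *\<^sub>R d) - G 0)\<bar>"
    by (simp add: \<tau> inner_diff_right)
  also have "\<dots> \<le> norm d * norm (G (x + \<tau> *\<^sub>R d) - G 0)"
    by (rule Cauchy_Schwarz_ineq2)
  also have "\<dots> \<le> norm d * (L * (norm x + norm d))"
    using lip[of "x + \<tau> *\<^sub>R d"] le small \<open>0 \<le> L\<close>
    by (intro mult_left_mono) (auto intro: order_trans mult_left_mono)
  finally show ?thesis
    by (simp add: mult_ac)
qed

text \<open>
  If \<open>H\<close> denotes the Hessian form at \<open>0\<close>, then \<open>f x\<close> is about \<open>x \<bullet> G 0 + H(x, x) / 2\<close> and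
  \<open>x \<bullet> G x\<close> about \<open>x \<bullet> G 0 + H(x, x)\<close>; eliminating \<open>H\<close> gives the estimate. It turns lower bounds on
  values into lower bounds on radial slopes.
\<close>

lemma second_order_error:
  assumes f: "\<And>y. GDERIV f y :> G y" and f0: "f 0 = 0" and A: "linear A"
    and approx: "\<And>y. norm y < \<rho> \<Longrightarrow> norm (G y - G 0 - A y) \<le> e * norm y"
    and x: "norm x < \<rho>" and "0 \<le> e"
  shows "\<bar>x \<bullet> G x - (2 * f x - x \<bullet> G 0)\<bar> \<le> 3 * e * (norm x)\<^sup>2"
proof -
  define h where "h t = f (t *\<^sub>R x) - t * (x \<bullet> G 0) - t\<^sup>2 / 2 * (x \<bullet> A x)" for t
  define h' where "h' t = x \<bullet> G (t *\<^sub>R x) - x \<bullet> G 0 - t * (x \<bullet> A x)" for t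
  have "(h has_real_derivative h' t) (at t)" for t
  proof -
    have 1: "((\<lambda>t. f (t *\<^sub>R x)) has_real_derivative x \<bullet> G (t *\<^sub>R x)) (at t)"
      using GDERIV_along_line[of f 0 t x] f by simp
    show ?thesis
      unfolding h_def h'_def by (rule derivative_eq_intros 1 refl | simp)+
  qed
  then obtain t where t: "0 < t" "t < 1" "h 1 - h 0 = h' t"
    using MVT2[of 0 1 h h'] by auto
  have bound: "\<bar>x \<bullet> G (u *\<^sub>R x) - x \<bullet> G 0 - u * (x \<bullet> A x)\<bar> \<le> e * (norm x)\<^sup>2"
    if "0 \<le> u" "u \<le> 1" for u
  proof -
    have le: "norm (u *\<^sub>R x) \<le> norm x"
      using that by (simp add: mult_left_le_one_le)
    have "\<bar>x \<bullet> G (u *\<^sub>R x) - x \<bullet> G 0 - u * (x \<bullet> A x)\<bar>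
        = \<bar>x \<bullet> (G (u *\<^sub>R x) - G 0 - A (u *\<^sub>R x))\<bar>"
      by (simp add: inner_diff_right linear_scale[OF A])
    also have "\<dots> \<le> norm x * norm (G (u *\<^sub>R x) - G 0 - A (u *\<^sub>R x))"
      by (rule Cauchy_Schwarz_ineq2)
    also have "\<dots> \<le> norm x * (e * norm x)"
      using approx[of "u *\<^sub>R x"] le x \<open>0 \<le> e\<close>
      by (intro mult_left_mono) (auto intro: order_trans mult_left_mono simp del: norm_scaleR)
    finally show ?thesis
      by (simp add: power2_eq_square mult_ac)
  qed
  have "h 1 - h 0 = f x - x \<bullet> G 0 - (x \<bullet> A x) / 2"
    by (simp add: h_def f0)
  then have "\<bar>f x - x \<bullet> G 0 - (x \<bullet> A x) / 2\<bar> \<le> e * (norm x)\<^sup>2"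
    using bound[of t] t by (simp add: h'_def)
  moreover have "\<bar>x \<bullet> G x - x \<bullet> G 0 - x \<bullet> A x\<bar> \<le> e * (norm x)\<^sup>2"
    using bound[of 1] by simp
  ultimately show ?thesis
    by linarith
qed

section \<open>Descent steps for a single piece\<close>

text \<open>
  The step scales \<open>x\<close> by \<open>1 - t\<close>, hence also \<open>f x\<close>, up to an error of at most
  \<open>3 * t * L * (norm x)\<^sup>2\<close>. The error is proportional to \<open>t\<close>, so that the bound is useful for
  arbitrarily short steps.
\<close>

lemma descent_at_high_value:
  assumes f: "\<And>y. GDERIV f y :> G y" and f0: "f 0 = 0"
    and lip: "\<And>y. norm y < \<rho> \<Longrightarrow> norm (G y - G 0) \<le> L * norm y"
    and x: "2 * norm x < \<rho>" and "0 \<le> L" and t: "0 \<le> t" "t \<le> 1"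
    and F: "f x \<le> F" "4 * L * (norm x)\<^sup>2 \<le> F"
  shows "f (x - t *\<^sub>R x) \<le> F - t * (L * (norm x)\<^sup>2)"
proof -
  have tx: "norm (- (t *\<^sub>R x)) \<le> norm x"
    using t by (simp add: mult_left_le_one_le)
  have "\<bar>f (x + - (t *\<^sub>R x)) - f x - (- (t *\<^sub>R x)) \<bullet> G 0\<bar>
      \<le> L * (norm x + norm (- (t *\<^sub>R x))) * norm (- (t *\<^sub>R x))"
    by (rule first_order_error[OF f lip]) (use x tx \<open>0 \<le> L\<close> in auto)
  also have "\<dots> \<le> L * (norm x + norm x) * (t * norm x)"
    using t tx \<open>0 \<le> L\<close> by (intro mult_mono) auto
  finally have "f (x - t *\<^sub>R x) - f x + t * (x \<bullet> G 0) \<le> 2 * t * (L * (norm x)\<^sup>2)"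
    by (simp add: power2_eq_square algebra_simps)
  moreover have "\<bar>f x - x \<bullet> G 0\<bar> \<le> L * (norm x)\<^sup>2"
    using first_order_error[of f G \<rho> L 0 x, OF f lip] x \<open>0 \<le> L\<close> norm_ge_zero[of x] by (simp add: f0 power2_eq_square mult_ac)
  then have "t * (f x - x \<bullet> G 0) \<le> t * (L * (norm x)\<^sup>2)"
    using t by (intro mult_left_mono) auto
  moreover have "(1 - t) * f x \<le> (1 - t) * F"
    using t F by (intro mult_left_mono) auto
  moreover have "t * (4 * (L * (norm x)\<^sup>2)) \<le> t * F"
    using t F by (intro mult_left_mono) (auto simp: mult_ac)
  ultimately show ?thesis
    by (simp add: algebra_simps)
qed

text \<open>
  The slope of \<open>f\<close> at \<open>x\<close> along \<open>v - x\<close> is \<open>v \<bullet> G x - x \<bullet> G x\<close>, and the choice of \<open>v\<close> makes this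
  \<open>- c\<close> once \<open>G x\<close> is replaced by \<open>G 0\<close> in the first product. The three error terms come from this
  replacement (third order), from the change of \<open>G\<close> along the step (small if \<open>t\<close> is), and from the
  deviation of \<open>G\<close> from its linearization. In the application \<open>c\<close> is the same for all pieces.
\<close>

lemma descent_along_corrected_ray:
  assumes f: "\<And>y. GDERIV f y :> G y" and A: "linear A"
    and lip: "\<And>y. norm y < \<rho> \<Longrightarrow> norm (G y - G 0) \<le> L * norm y"
    and approx: "\<And>y. norm y < \<rho> \<Longrightarrow> norm (G y - G 0 - A y) \<le> e * norm y"
    and bound: "\<And>y. norm (A y) \<le> L * norm y"
    and x: "3 * norm x < \<rho>" and nonneg: "0 \<le> L" "0 \<le> e"
    and v: "norm v \<le> norm x" "norm v \<le> k * (norm x)\<^sup>2" "v \<bullet> G 0 = x \<bullet> G x - c"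
    and t: "0 < t" "t \<le> 1"
  shows "f (x + t *\<^sub>R (v - x)) \<le> f x - t * (c - (3 * L * k * norm x + 2 * L * t + 4 * e) * (norm x)\<^sup>2)"
proof -
  obtain \<tau> where \<tau>: "0 < \<tau>" "\<tau> < t"
    and mv: "f (x + t *\<^sub>R (v - x)) - f x = t * ((v - x) \<bullet> G (x + \<tau> *\<^sub>R (v - x)))"
    using GDERIV_mean_value[of f G t x "v - x"] f t by auto
  define y where "y = x + \<tau> *\<^sub>R (v - x)"
  have vx: "norm (v - x) \<le> 2 * norm x"
    using norm_triangle_ineq4[of v x] v by simp
  have d: "norm (y - x) \<le> t * (2 * norm x)"
    unfolding y_def using \<tau> vx by (auto intro!: mult_mono)
  also have "\<dots> \<le> 2 * norm x"
    using t by (simp add: mult_left_le_one_le)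
  finally have y: "norm y \<le> 3 * norm x"
    using norm_triangle_sub[of y x] by simp
  have "v \<bullet> (G y - G 0) \<le> norm v * norm (G y - G 0)"
    by (rule norm_cauchy_schwarz)
  also have "\<dots> \<le> (k * (norm x)\<^sup>2) * (L * (3 * norm x))"
  proof (rule mult_mono)
    have "norm (G y - G 0) \<le> L * norm y"
      using y x by (intro lip) simp
    also have "\<dots> \<le> L * (3 * norm x)"
      using y nonneg by (intro mult_left_mono)
    finally show "norm (G y - G 0) \<le> L * (3 * norm x)" .
    show "0 \<le> k * (norm x)\<^sup>2"
      using v norm_ge_zero[of v] by linarith
  qed (use v in auto)
  finally have 1: "v \<bullet> G y - v \<bullet> G 0 \<le> 3 * L * k * norm x * (norm x)\<^sup>2"
    by (simp add: inner_diff_right mult_ac)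
  have "norm (G x - G y) = norm ((G x - G 0 - A x) - (G y - G 0 - A y) - A (y - x))"
    by (simp add: linear_diff[OF A])
  also have "\<dots> \<le> norm (G x - G 0 - A x) + norm (G y - G 0 - A y) + norm (A (y - x))"
    using norm_triangle_ineq4 by (smt (verit))
  also have "\<dots> \<le> e * norm x + e * (3 * norm x) + L * (t * (2 * norm x))"
  proof (intro add_mono)
    show "norm (G x - G 0 - A x) \<le> e * norm x"
      using x norm_ge_zero[of x] by (intro approx) linarith
    have "norm (G y - G 0 - A y) \<le> e * norm y"
      using x y by (intro approx) simp
    also have "\<dots> \<le> e * (3 * norm x)"
      using y nonneg by (intro mult_left_mono)
    finally show "norm (G y - G 0 - A y) \<le> e * (3 * norm x)" .
    have "norm (A (y - x)) \<le> L * norm (y - x)"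
      by (rule bound)
    also have "\<dots> \<le> L * (t * (2 * norm x))"
      using d nonneg by (intro mult_left_mono)
    finally show "norm (A (y - x)) \<le> L * (t * (2 * norm x))" .
  qed
  finally have "norm (G x - G y) \<le> (4 * e + 2 * L * t) * norm x"
    by (simp add: algebra_simps)
  then have "norm x * norm (G x - G y) \<le> norm x * ((4 * e + 2 * L * t) * norm x)"
    by (rule mult_left_mono) simp
  with norm_cauchy_schwarz[of x "G x - G y"]
  have 2: "x \<bullet> G x - x \<bullet> G y \<le> (2 * L * t + 4 * e) * (norm x)\<^sup>2"
    by (simp add: inner_diff_right power2_eq_square algebra_simps)
  have "(v - x) \<bullet> G y \<le> - (c - (3 * L * k * norm x + 2 * L * t + 4 * e) * (norm x)\<^sup>2)"
    using 1 2 v(3) by (simp add: inner_diff_left algebra_simps)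
  then have "t * ((v - x) \<bullet> G y) \<le> t * - (c - (3 * L * k * norm x + 2 * L * t + 4 * e) * (norm x)\<^sup>2)"
    using t by (intro mult_left_mono) auto
  then show ?thesis
    using mv unfolding y_def mult_minus_right by linarith
qed

section \<open>Descent for all pieces at once\<close>

text \<open>
  At \<open>x + v\<close> every piece equals \<open>m\<close> up to an error of third order, while one of them is at least
  \<open>\<beta> * (norm (x + v))\<^sup>2\<close>, which is not much less than \<open>\<beta> * (norm x)\<^sup>2\<close>.
\<close>

lemma growth_of_weighted_mean:
  fixes fs :: "'s \<Rightarrow> 'a::euclidean_space \<Rightarrow> real"
  assumes f: "\<And>s y. s \<in> S \<Longrightarrow> GDERIV (fs s) y :> G s y"
    and lip: "\<And>s y. \<lbrakk>s \<in> S; norm y < \<rho>\<rbrakk> \<Longrightarrow> norm (G s y - G s 0) \<le> L * norm y"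
    and "0 \<le> L"
    and growth: "\<And>y. norm y < \<rho> \<Longrightarrow> \<exists>s\<in>S. \<beta> * (norm y)\<^sup>2 \<le> fs s y" and "0 < \<beta>"
    and v: "norm v \<le> k * (norm x)\<^sup>2" "\<And>s. s \<in> S \<Longrightarrow> v \<bullet> G s 0 = m - fs s x"
    and x: "2 * norm x < \<rho>" "k * norm x \<le> 1 / 4" "8 * L * k * norm x \<le> \<beta>"
  shows "\<beta> / 4 * (norm x)\<^sup>2 \<le> m"
proof -
  have "k * (norm x)\<^sup>2 \<le> 1 / 4 * norm x"
    using mult_right_mono[OF x(2) norm_ge_zero[of x]] by (simp add: power2_eq_square mult_ac)
  with v have v4: "norm v \<le> norm x / 4"
    by simp
  have "norm (x + v) \<le> 2 * norm x"
    using norm_triangle_ineq[of x v] v4 norm_ge_zero[of x] by linarith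
  then obtain s where s: "s \<in> S" "\<beta> * (norm (x + v))\<^sup>2 \<le> fs s (x + v)"
    using growth x by force
  have "3 / 4 * norm x \<le> norm (x + v)"
    using norm_diff_ineq[of x v] v4 by linarith
  then have "(3 / 4 * norm x)\<^sup>2 \<le> (norm (x + v))\<^sup>2"
    by (rule power_mono) simp
  moreover have "(3 / 4 * norm x)\<^sup>2 = 9 / 16 * (norm x)\<^sup>2"
    by (simp add: power2_eq_square)
  ultimately have "1 / 2 * (norm x)\<^sup>2 \<le> (norm (x + v))\<^sup>2"
    using zero_le_power2[of "norm (x + v)"] by linarith
  then have "\<beta> * (1 / 2 * (norm x)\<^sup>2) \<le> \<beta> * (norm (x + v))\<^sup>2"
    using \<open>0 < \<beta>\<close> by (intro mult_left_mono) auto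
  moreover have "fs s (x + v) - fs s x - v \<bullet> G s 0 \<le> L * (norm x + norm v) * norm v"
    using first_order_error[of "fs s" "G s" \<rho> L x v, OF f[OF s(1)] lip[OF s(1)] _ \<open>0 \<le> L\<close>] x v4 norm_ge_zero[of x]
    by linarith
  moreover have "L * (norm x + norm v) * norm v \<le> L * (2 * norm x) * (k * (norm x)\<^sup>2)"
  proof (rule mult_mono)
    show "L * (norm x + norm v) \<le> L * (2 * norm x)"
      using v4 norm_ge_zero[of x] \<open>0 \<le> L\<close> by (intro mult_left_mono) linarith+
  qed (use v \<open>0 \<le> L\<close> in auto)
  moreover have "L * (2 * norm x) * (k * (norm x)\<^sup>2) \<le> \<beta> / 4 * (norm x)\<^sup>2"
    using mult_right_mono[OF x(3) zero_le_power2[of "norm x"]] by (simp add: mult_ac)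
  ultimately show ?thesis
    using s v(2)[OF s(1)] by simp
qed

lemma uniform_linear_approximation:
  fixes G :: "'s \<Rightarrow> 'a::real_normed_vector \<Rightarrow> 'b::real_normed_vector"
  assumes "finite S" "\<And>s. s \<in> S \<Longrightarrow> (G s has_derivative A s) (at 0)" "0 < e"
  obtains \<rho> where "\<rho> > 0"
    and "\<And>s y. \<lbrakk>s \<in> S; norm y < \<rho>\<rbrakk> \<Longrightarrow> norm (G s y - G s 0 - A s y) \<le> e * norm y"
proof -
  have "\<forall>\<^sub>F y in nhds 0. norm (G s y - G s 0 - A s y) \<le> e * norm y" if "s \<in> S" for s
    using assms that by (auto simp: has_derivative_at_alt eventually_nhds_metric)
  then have "\<forall>\<^sub>F y in nhds 0. \<forall>s\<in>S. norm (G s y - G s 0 - A s y) \<le> e * norm y"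
    using assms by (intro eventually_ball_finite) auto
  then show thesis
    using that by (auto simp: eventually_nhds_metric)
qed

lemma uniform_linear_bound:
  fixes A :: "'s \<Rightarrow> 'a::real_normed_vector \<Rightarrow> 'b::real_normed_vector"
  assumes "finite S" "\<And>s. s \<in> S \<Longrightarrow> bounded_linear (A s)"
  obtains L where "L > 0" "\<And>s y. s \<in> S \<Longrightarrow> norm (A s y) \<le> L * norm y"
proof
  show "1 + (\<Sum>s\<in>S. onorm (A s)) > 0"
    using assms by (intro add_pos_nonneg sum_nonneg) (auto intro: onorm_pos_le)
  fix s y assume s: "s \<in> S"
  have "norm (A s y) \<le> onorm (A s) * norm y"
    using assms s by (intro onorm) auto
  also have "onorm (A s) \<le> (\<Sum>s\<in>S. onorm (A s))"
    using assms s by (intro member_le_sum) (auto intro: onorm_pos_le)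
  then have "onorm (A s) * norm y \<le> (1 + (\<Sum>s\<in>S. onorm (A s))) * norm y"
    by (intro mult_right_mono) auto
  finally show "norm (A s y) \<le> (1 + (\<Sum>s\<in>S. onorm (A s))) * norm y" .
qed

text \<open>
  The constant \<open>M\<close> bounds values and radial slopes by \<open>M * (norm x)\<^sup>2\<close> in the low-value case, and
  \<open>k\<close> bounds the resulting corrections by \<open>k * (norm x)\<^sup>2\<close>. Each of the three error terms of
  \<open>descent_along_corrected_ray\<close> is allowed \<open>\<beta> / 24 * (norm x)\<^sup>2\<close>; together they use up half
  of the rate \<open>\<beta> / 4 * (norm x)\<^sup>2\<close> guaranteed by the growth. This determines the choices of \<open>e\<close>, \<open>t0\<close> and \<open>r\<close>.
\<close>

lemma uniform_quadratic_descent: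
  fixes fs :: "'s \<Rightarrow> 'a::euclidean_space \<Rightarrow> real"
  assumes S: "finite S"
    and f: "\<And>s y. s \<in> S \<Longrightarrow> GDERIV (fs s) y :> G s y" and f0: "\<And>s. s \<in> S \<Longrightarrow> fs s 0 = 0"
    and G: "\<And>s. s \<in> S \<Longrightarrow> (G s has_derivative A s) (at 0)"
    and growth: "\<And>y. norm y < \<rho>0 \<Longrightarrow> \<exists>s\<in>S. \<beta> * (norm y)\<^sup>2 \<le> fs s y" "0 < \<rho>0" "0 < \<beta>"
    and pos: "\<And>s. s \<in> S \<Longrightarrow> 0 < lam s" and lam: "sum lam S = 1" "(\<Sum>s\<in>S. lam s *\<^sub>R G s 0) = 0"
    and indep: "affinely_independent_family S (\<lambda>s. G s 0)"
  obtains r C where "r > 0" "C > 0"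
    and "\<And>x \<Delta> F. \<lbrakk>norm x < r; 0 < \<Delta>; \<Delta> < norm x; \<And>s. s \<in> S \<Longrightarrow> fs s x \<le> F\<rbrakk>
           \<Longrightarrow> \<exists>z\<in>cball x \<Delta>. \<forall>s\<in>S. fs s z \<le> F - C * \<Delta>\<^sup>2"
proof -
  have "S \<noteq> {}"
    using lam by auto
  have lin: "bounded_linear (A s)" if "s \<in> S" for s
    using G[OF that] by (rule has_derivative_bounded_linear)
  obtain L0 where L0: "L0 > 0" "\<And>s y. s \<in> S \<Longrightarrow> norm (A s y) \<le> L0 * norm y"
    using uniform_linear_bound[of S A, OF S lin] by blast
  define L where "L = L0 + 1"
  have L: "L > 0" "\<And>s y. s \<in> S \<Longrightarrow> norm (A s y) \<le> L * norm y"
    using L0 by (auto simp: L_def distrib_right intro: add_increasing2)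
  \<comment> \<open>\<open>e \<le> 1\<close> turns the linear approximation into the Lipschitz estimate with \<open>L0 + 1\<close>;
    \<open>\<beta> / 96\<close> makes the term \<open>4 * e\<close> at most \<open>\<beta> / 24\<close>.\<close>
  define e where "e = min 1 (\<beta> / 96)"
  have e: "0 < e" "e \<le> 1" "e \<le> \<beta> / 96"
    using \<open>0 < \<beta>\<close> by (auto simp: e_def)
  obtain \<rho>1 where \<rho>1: "\<rho>1 > 0"
    "\<And>s y. \<lbrakk>s \<in> S; norm y < \<rho>1\<rbrakk> \<Longrightarrow> norm (G s y - G s 0 - A s y) \<le> e * norm y"
    using uniform_linear_approximation[of S G A, OF S G e(1)] by blast
  define \<rho> where "\<rho> = min \<rho>0 \<rho>1"
  have \<rho>: "0 < \<rho>"
    using \<rho>1 growth by (simp add: \<rho>_def)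
  have approx: "norm (G s y - G s 0 - A s y) \<le> e * norm y" if "s \<in> S" "norm y < \<rho>" for s y
    using \<rho>1 that by (simp add: \<rho>_def)
  have growth': "\<exists>s\<in>S. \<beta> * (norm y)\<^sup>2 \<le> fs s y" if "norm y < \<rho>" for y
    using growth that by (simp add: \<rho>_def)
  have lip: "norm (G s y - G s 0) \<le> L * norm y" if "s \<in> S" "norm y < \<rho>" for s y
  proof -
    have "norm (G s y - G s 0) \<le> norm (A s y) + norm (G s y - G s 0 - A s y)"
      by (rule norm_triangle_sub)
    also have "\<dots> \<le> L0 * norm y + e * norm y"
      using approx L0 that by (intro add_mono) auto
    also have "\<dots> \<le> L0 * norm y + 1 * norm y"
      using e by (intro add_mono mult_right_mono) auto
    finally show ?thesis
      by (simp add: L_def algebra_simps)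
  qed
  obtain K where K: "K > 0"
    and solve: "\<And>a M. \<lbrakk>(\<Sum>s\<in>S. lam s * a s) = 0; \<And>s. s \<in> S \<Longrightarrow> \<bar>a s\<bar> \<le> M\<rbrakk>
           \<Longrightarrow> \<exists>v. norm v \<le> K * M \<and> (\<forall>s\<in>S. v \<bullet> G s 0 = a s)"
    using exists_small_solution[OF S lam indep] by blast
  define l where "l = Min (lam ` S)"
  have l: "0 < l" "\<And>s. s \<in> S \<Longrightarrow> l \<le> lam s"
    using S \<open>S \<noteq> {}\<close> pos by (auto simp: l_def)
  define M where "M = 5 * L / l + L"
  have M: "M > 0"
    using L l by (simp add: M_def add_pos_pos)
  define k where "k = 2 * K * M"
  have k: "k > 0"
    using K M by (simp add: k_def)
  define t0 where "t0 = min (1 / 2) (\<beta> / (48 * L))"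
  have t0: "0 < t0" "t0 \<le> 1 / 2" "2 * L * t0 \<le> \<beta> / 24"
    using L \<open>0 < \<beta>\<close> by (auto simp: t0_def min_def field_simps)
  define C where "C = min L (t0 * (\<beta> / 8))"
  have C: "C > 0" "C \<le> L" "C \<le> t0 * (\<beta> / 8)"
    using L t0 \<open>0 < \<beta>\<close> by (auto simp: C_def)
  define r where "r = min (\<rho> / 3) (min (1 / (4 * k)) (\<beta> / (72 * L * k)))"
  have "r > 0"
    using \<rho> k L \<open>0 < \<beta>\<close> by (simp add: r_def)
  show thesis
  proof (rule that[OF \<open>r > 0\<close> \<open>C > 0\<close>])
    fix x :: 'a and \<Delta> F :: real
    assume x: "norm x < r" and \<Delta>: "0 < \<Delta>" "\<Delta> < norm x" and F: "\<And>s. s \<in> S \<Longrightarrow> fs s x \<le> F"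
    have x0: "norm x > 0"
      using \<Delta> by linarith
    have x1: "3 * norm x < \<rho>" "norm x \<le> 1 / (4 * k)" "norm x \<le> \<beta> / (72 * L * k)"
      using x by (auto simp: r_def)
    have x3: "2 * norm x < \<rho>" "norm x < \<rho>"
      using x1(1) x0 by linarith+
    from x1 have x2: "k * norm x \<le> 1 / 4" "72 * L * k * norm x \<le> \<beta>"
      using k L by (auto simp: field_simps)
    \<comment> \<open>A decrease of order \<open>\<Delta> * norm x\<close> exceeds one of order \<open>\<Delta>\<^sup>2\<close>; the fraction is the step parameter \<open>t\<close>.\<close>
    have step: "c * \<Delta>\<^sup>2 \<le> c * \<Delta> / norm x * (norm x)\<^sup>2" if "0 \<le> c" for c
    proof -
      have "c * \<Delta> * \<Delta> \<le> c * \<Delta> * norm x"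
        using \<Delta> that by (intro mult_left_mono) auto
      then show ?thesis
        using x0 by (simp add: power2_eq_square)
    qed
    show "\<exists>z\<in>cball x \<Delta>. \<forall>s\<in>S. fs s z \<le> F - C * \<Delta>\<^sup>2"
    proof (cases "4 * L * (norm x)\<^sup>2 \<le> F")
      case True
      define t where "t = \<Delta> / norm x"
      have t: "0 \<le> t" "t \<le> 1"
        using \<Delta> x0 by (auto simp: t_def)
      have "x - t *\<^sub>R x \<in> cball x \<Delta>"
        using \<Delta> x0 by (simp add: dist_norm t_def)
      moreover have "fs s (x - t *\<^sub>R x) \<le> F - C * \<Delta>\<^sup>2" if s: "s \<in> S" for s
      proof -
        have "fs s (x - t *\<^sub>R x) \<le> F - t * (L * (norm x)\<^sup>2)"
          by (rule descent_at_high_value[where G = "G s" and \<rho> = \<rho>])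
            (use f f0 lip s x3 L t F True in auto)
        moreover have "L * \<Delta>\<^sup>2 \<le> t * (L * (norm x)\<^sup>2)"
          using step[of L] L by (simp add: t_def mult_ac)
        moreover have "C * \<Delta>\<^sup>2 \<le> L * \<Delta>\<^sup>2"
          using C by (intro mult_right_mono) auto
        ultimately show ?thesis
          by linarith
      qed
      ultimately show ?thesis
        by blast
    next
      case False
      have first: "\<bar>fs s x - x \<bullet> G s 0\<bar> \<le> L * (norm x)\<^sup>2" if "s \<in> S" for s
        using first_order_error[of "fs s" "G s" \<rho> L 0 x, OF f[OF that] lip[OF that]] that x3 L f0
        by (simp add: power2_eq_square mult_ac)
      have slope0: "\<bar>x \<bullet> G s 0\<bar> \<le> 5 * L / l * (norm x)\<^sup>2" if s: "s \<in> S" for s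
      proof -
        have "(\<Sum>s\<in>S. lam s * (x \<bullet> G s 0)) = x \<bullet> (\<Sum>s\<in>S. lam s *\<^sub>R G s 0)"
          by (simp add: inner_sum_right)
        then have "(\<Sum>s\<in>S. lam s * (x \<bullet> G s 0)) = 0"
          by (simp add: lam)
        moreover have "x \<bullet> G s 0 \<le> 5 * L * (norm x)\<^sup>2" if "s \<in> S" for s
          using first[OF that] F[OF that] False by (simp add: abs_le_iff)
        ultimately have "\<bar>x \<bullet> G s 0\<bar> \<le> 5 * L * (norm x)\<^sup>2 / l"
          using s l S pos lam
          by (intro abs_le_of_weighted_sum_zero[of S lam "\<lambda>s. x \<bullet> G s 0"]) auto
        then show ?thesis
          by simp
      qed
      have val: "\<bar>- fs s x\<bar> \<le> M * (norm x)\<^sup>2" if "s \<in> S" for s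
        using first[OF that] slope0[OF that] by (simp add: M_def algebra_simps)
      have slope: "\<bar>x \<bullet> G s x\<bar> \<le> M * (norm x)\<^sup>2" if s: "s \<in> S" for s
      proof -
        have "\<bar>x \<bullet> (G s x - G s 0)\<bar> \<le> norm x * norm (G s x - G s 0)"
          by (rule Cauchy_Schwarz_ineq2)
        also have "\<dots> \<le> norm x * (L * norm x)"
          using lip[OF s, of x] x3 by (intro mult_left_mono) auto
        finally show ?thesis
          using slope0[OF s] by (simp add: M_def power2_eq_square inner_diff_right algebra_simps)
      qed
      define m where "m = (\<Sum>s\<in>S. lam s * fs s x)"
      have pos': "\<And>s. s \<in> S \<Longrightarrow> 0 \<le> lam s"
        using pos by (simp add: less_imp_le)
      \<comment> \<open>levels the values: the system is solved for the negated values, whose mean is \<open>- m\<close>\<close>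
      obtain v' where v': "norm v' \<le> k * (norm x)\<^sup>2" "\<And>s. s \<in> S \<Longrightarrow> v' \<bullet> G s 0 = m - fs s x"
      proof (rule small_equalizing_correction[where S = S and lam = lam and K = K
            and g = "\<lambda>s. G s 0" and b = "\<lambda>s. - fs s x", OF pos' lam(1) solve val])
        fix w
        assume "norm w \<le> 2 * K * (M * (norm x)\<^sup>2)"
          "\<And>s. s \<in> S \<Longrightarrow> w \<bullet> G s 0 = - fs s x - (\<Sum>r\<in>S. lam r * - fs r x)"
        then show thesis
          by (intro that[of w]) (auto simp: m_def k_def sum_negf mult.assoc)
      qed auto
      have "8 * L * k * norm x \<le> \<beta>"
      proof -
        have "0 \<le> L * k * norm x"
          using L(1) k by simp
        then show ?thesis
          using x2(2) by linarith
      qed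
      then have m: "\<beta> / 4 * (norm x)\<^sup>2 \<le> m"
        using growth_of_weighted_mean[OF f lip _ growth' \<open>0 < \<beta>\<close> v'] L x3 x2 by simp
      define c where "c = (\<Sum>s\<in>S. lam s * (x \<bullet> G s x))"
      \<comment> \<open>levels the slopes along the ray to the origin\<close>
      obtain v where v: "norm v \<le> k * (norm x)\<^sup>2" "\<And>s. s \<in> S \<Longrightarrow> v \<bullet> G s 0 = x \<bullet> G s x - c"
      proof (rule small_equalizing_correction[where S = S and lam = lam and K = K
            and g = "\<lambda>s. G s 0" and b = "\<lambda>s. x \<bullet> G s x", OF pos' lam(1) solve slope])
        fix w
        assume "norm w \<le> 2 * K * (M * (norm x)\<^sup>2)"
          "\<And>s. s \<in> S \<Longrightarrow> w \<bullet> G s 0 = x \<bullet> G s x - (\<Sum>r\<in>S. lam r * (x \<bullet> G r x))"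
        then show thesis
          by (intro that[of w]) (auto simp: c_def k_def mult.assoc)
      qed auto
      have c: "\<beta> / 4 * (norm x)\<^sup>2 \<le> c"
      proof -
        have "\<bar>\<Sum>s\<in>S. lam s * (x \<bullet> G s x - (2 * fs s x - x \<bullet> G s 0))\<bar> \<le> 3 * e * (norm x)\<^sup>2"
        proof (rule abs_weighted_mean_le[OF pos' lam(1)])
          fix s assume s: "s \<in> S"
          show "\<bar>x \<bullet> G s x - (2 * fs s x - x \<bullet> G s 0)\<bar> \<le> 3 * e * (norm x)\<^sup>2"
            by (rule second_order_error[where \<rho> = \<rho> and A = "A s"])
              (use f f0 approx s x3 e has_derivative_linear[OF G[OF s]] in auto)
        qed
        also have "(\<Sum>s\<in>S. lam s * (x \<bullet> G s x - (2 * fs s x - x \<bullet> G s 0)))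
            = c - 2 * m + x \<bullet> (\<Sum>s\<in>S. lam s *\<^sub>R G s 0)"
          by (simp add: c_def m_def inner_sum_right sum_distrib_left sum_subtractf sum.distrib algebra_simps)
        finally have "2 * m - 3 * e * (norm x)\<^sup>2 \<le> c"
          by (simp add: lam)
        moreover have "e * (norm x)\<^sup>2 \<le> \<beta> / 96 * (norm x)\<^sup>2"
          using e by (intro mult_right_mono) auto
        moreover have "0 \<le> \<beta> * (norm x)\<^sup>2"
          using \<open>0 < \<beta>\<close> by simp
        ultimately show ?thesis
          using m by simp
      qed
      have "k * (norm x)\<^sup>2 \<le> 1 / 4 * norm x"
        using mult_right_mono[OF x2(1) norm_ge_zero[of x]] by (simp add: power2_eq_square mult_ac)
      with v(1) norm_ge_zero[of x] have vx: "norm v \<le> norm x"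
        by linarith
      \<comment> \<open>The factor \<open>t0 \<le> 1 / 2\<close> keeps the step within \<open>\<Delta>\<close>, since \<open>norm (v - x) \<le> 2 * norm x\<close>.\<close>
      define t where "t = t0 * \<Delta> / norm x"
      have t: "0 < t" "t \<le> t0"
        using t0 \<Delta> x0 by (auto simp: t_def field_simps)
      have "x + t *\<^sub>R (v - x) \<in> cball x \<Delta>"
      proof -
        have "norm (v - x) \<le> 2 * norm x"
          using norm_triangle_ineq4[of v x] vx by simp
        then have "t * norm (v - x) \<le> t * (2 * norm x)"
          using t by (intro mult_left_mono) auto
        also have "\<dots> = 2 * t0 * \<Delta>"
          using x0 by (simp add: t_def)
        also have "\<dots> \<le> \<Delta>"
          using t0 \<Delta> by simp
        finally show ?thesis
          using t by (simp add: dist_norm)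
      qed
      moreover have "fs s (x + t *\<^sub>R (v - x)) \<le> F - C * \<Delta>\<^sup>2" if s: "s \<in> S" for s
      proof -
        have "fs s (x + t *\<^sub>R (v - x))
            \<le> fs s x - t * (c - (3 * L * k * norm x + 2 * L * t + 4 * e) * (norm x)\<^sup>2)"
          by (rule descent_along_corrected_ray[where G = "G s" and A = "A s" and \<rho> = \<rho>])
            (use f lip approx L s x1 e v vx t t0 has_derivative_linear[OF G[OF s]] in auto)
        moreover have "t * (\<beta> / 8 * (norm x)\<^sup>2)
            \<le> t * (c - (3 * L * k * norm x + 2 * L * t + 4 * e) * (norm x)\<^sup>2)"
        proof (rule mult_left_mono)
          have "2 * L * t \<le> 2 * L * t0"
            using t L by simp
          then have "3 * L * k * norm x + 2 * L * t + 4 * e \<le> \<beta> / 8"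
            using x2 t0 e by simp
          then have "(3 * L * k * norm x + 2 * L * t + 4 * e) * (norm x)\<^sup>2 \<le> \<beta> / 8 * (norm x)\<^sup>2"
            by (rule mult_right_mono) simp
          then show "\<beta> / 8 * (norm x)\<^sup>2
              \<le> c - (3 * L * k * norm x + 2 * L * t + 4 * e) * (norm x)\<^sup>2"
            using c by simp
        qed (use t in simp)
        moreover have "t0 * (\<beta> / 8) * \<Delta>\<^sup>2 \<le> t * (\<beta> / 8 * (norm x)\<^sup>2)"
          using step[of "t0 * (\<beta> / 8)"] t0 \<open>0 < \<beta>\<close> by (simp add: t_def mult_ac)
        moreover have "C * \<Delta>\<^sup>2 \<le> t0 * (\<beta> / 8) * \<Delta>\<^sup>2"
          using C by (intro mult_right_mono) auto
        ultimately show ?thesis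
          using F[OF s] by linarith
      qed
      ultimately show ?thesis
        by blast
    qed
  qed
qed

section \<open>Gradients of continuously differentiable functions\<close>

text \<open>
  The sum in the second equation makes visible that the gradient inherits differentiability from the
  directional derivatives.
\<close>

lemma gradient_eq:
  fixes f :: "'a::euclidean_space \<Rightarrow> real"
  assumes "f differentiable at x"
  shows "GDERIV f x :> gradient f x"
    and "gradient f x = (\<Sum>b\<in>Basis. frechet_derivative f (at x) b *\<^sub>R b)"
proof -
  let ?D = "\<Sum>b\<in>Basis. frechet_derivative f (at x) b *\<^sub>R b"
  have lin: "linear (frechet_derivative f (at x))"
    using assms by (rule linear_frechet_derivative)
  have eq: "frechet_derivative f (at x) h = h \<bullet> ?D" for h
  proof -
    have "frechet_derivative f (at x) h
        = frechet_derivative f (at x) (\<Sum>b\<in>Basis. (h \<bullet> b) *\<^sub>R b)"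
      by (simp add: euclidean_representation)
    also have "\<dots> = h \<bullet> ?D"
      by (simp add: linear_sum[OF lin] linear_scale[OF lin] inner_sum_right mult.commute)
    finally show ?thesis .
  qed
  have 1: "GDERIV f x :> ?D"
    using assms[unfolded frechet_derivative_works] unfolding gderiv_def eq[symmetric] by simp
  have uniq: "D = ?D" if "GDERIV f x :> D" for D
  proof -
    have "(\<lambda>h. h \<bullet> D) = (\<lambda>h. h \<bullet> ?D)"
      using that 1 unfolding gderiv_def by (rule has_derivative_unique)
    then have "b \<bullet> D = b \<bullet> ?D" for b
      by meson
    then show ?thesis
      by (meson vector_eq_ldot)
  qed
  have "gradient f x = ?D"
    unfolding gradient_def using 1 uniq by (rule the_equality)
  with 1 show "GDERIV f x :> gradient f x" "gradient f x = ?D"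
    by simp_all
qed

lemma gradient_differentiable:
  assumes "k_times_cont_diff (Suc (Suc k)) f"
  shows "gradient f differentiable at x"
proof -
  have "gradient f = (\<lambda>x. \<Sum>b\<in>Basis. frechet_derivative f (at x) b *\<^sub>R b)"
    using gradient_eq(2)[of f] assms by (intro ext) simp
  moreover have "(\<lambda>x. frechet_derivative f (at x) b) differentiable at x" for b
    using assms by simp
  ultimately show ?thesis
    by simp
qed

section \<open>Property (P) for finite maxima\<close>

lemma continuous_on_Max_finite:
  fixes fs :: "'s \<Rightarrow> 'a::topological_space \<Rightarrow> 'b::linorder_topology"
  assumes "finite S" "S \<noteq> {}" "\<And>s. s \<in> S \<Longrightarrow> continuous_on X (fs s)"
  shows "continuous_on X (\<lambda>x. MAX s\<in>S. fs s x)"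
  using assms
proof (induction S rule: finite_ne_induct)
  case (insert s S)
  then have "(\<lambda>x. MAX s\<in>insert s S. fs s x) = (\<lambda>x. max (fs s x) (MAX s\<in>S. fs s x))"
    by simp
  then show ?case
    using insert by (simp add: continuous_on_max)
qed simp

lemma Lambda_ge:
  fixes f :: "'a::euclidean_space \<Rightarrow> real"
  assumes "continuous_on (cball x \<Delta>) f" "0 < \<Delta>" "z \<in> cball x \<Delta>" "f z \<le> f x - C * \<Delta> ^ p"
  shows "C \<le> Lambda f p x \<Delta>"
proof -
  obtain y where y: "y \<in> cball x \<Delta>" "\<And>w. w \<in> cball x \<Delta> \<Longrightarrow> f y \<le> f w"
    using continuous_attains_inf[OF compact_cball _ assms(1)] assms(3) by blast
  then have "f y \<le> f x - C * \<Delta> ^ p"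
    using assms by (meson order_trans)
  then have "C * \<Delta> ^ p \<le> f x - f y"
    by simp
  then show ?thesis
    using \<open>0 < \<Delta>\<close> Lambda_eq[of y x \<Delta> f p, OF y] by (simp add: pos_le_divide_eq)
qed

theorem theorem4p2:
  fixes q m :: nat
    and S :: "nat set"
    and fs :: "nat \<Rightarrow> real ^ 'n \<Rightarrow> real"
    and f :: "real ^ 'n \<Rightarrow> real"
    and xs :: "real ^ 'n"
  assumes "q \<ge> 2"
    and "m \<ge> 1"
    and "S = {1..m}"
    and "\<And>s. s \<in> S \<Longrightarrow> k_times_cont_diff (q + 1) (fs s)"
    and "\<And>x. f x = (MAX s\<in>S. fs s x)"
    and "grows_with_order 2 f xs"
    and "active_set S fs f xs = S"
    and "\<exists>l :: nat \<Rightarrow> real. (\<forall>s\<in>S. l s > 0) \<and> (\<Sum>s\<in>S. l s) = 1 \<and>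
           (\<Sum>s\<in>S. l s *\<^sub>R gradient (fs s) xs) = 0"
    and "affinely_independent_family S (\<lambda>s. gradient (fs s) xs)"
  shows "property_P f 2 xs"
proof -
  have S: "finite S" "S \<noteq> {}"
    using assms(2,3) by auto
  obtain j where j: "q + 1 = Suc (Suc j)"
    using assms(1) by (metis Suc_eq_plus1 Suc_le_D numeral_2_eq_2)
  have smooth: "k_times_cont_diff (Suc (Suc j)) (fs s)" if "s \<in> S" for s
    using assms(4)[OF that] unfolding j .
  have diff: "fs s differentiable at x" if "s \<in> S" for s x
    using smooth[OF that] by simp
  define hs where "hs s y = fs s (xs + y) - f xs" for s y
  define G where "G s y = gradient (fs s) (xs + y)" for s y
  have shift: "((\<lambda>y. xs + y) has_derivative (\<lambda>h. h)) (at y)" for y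
    by (auto intro!: derivative_eq_intros)
  have deriv: "GDERIV (hs s) y :> G s y" if "s \<in> S" for s y
    using has_derivative_compose[OF shift, of "fs s"] gradient_eq(1)[OF diff[OF that]]
    unfolding hs_def G_def gderiv_def by (auto intro!: derivative_eq_intros)
  have "\<exists>A. (G s has_derivative A) (at 0)" if s: "s \<in> S" for s
  proof -
    obtain A where "(gradient (fs s) has_derivative A) (at xs)"
      using gradient_differentiable[OF smooth[OF s]] unfolding differentiable_def by blast
    then show ?thesis
      using has_derivative_compose[OF shift, of "gradient (fs s)" A 0] unfolding G_def by auto
  qed
  then obtain A where A: "\<And>s. s \<in> S \<Longrightarrow> (G s has_derivative A s) (at 0)"
    by metis
  have le_f: "fs s x \<le> f x" if "s \<in> S" for s x
    using S that by (simp add: assms(5))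
  have attained: "\<exists>s\<in>S. f x = fs s x" for x
    using Max_in[of "(\<lambda>s. fs s x) ` S"] S unfolding assms(5) by blast
  obtain V \<beta> where V: "open V" "xs \<in> V" "\<beta> > 0"
    "\<And>x. x \<in> V \<Longrightarrow> f x \<ge> f xs + \<beta> * norm (x - xs) ^ 2"
    using assms(6) unfolding grows_with_order_def by blast
  obtain \<rho> where \<rho>: "\<rho> > 0" "ball xs \<rho> \<subseteq> V"
    using V by (meson openE)
  have growth: "\<exists>s\<in>S. \<beta> * (norm y)\<^sup>2 \<le> hs s y" if "norm y < \<rho>" for y
  proof -
    have "xs + y \<in> V"
      using \<rho> that by (auto simp: dist_norm)
    then have "f xs + \<beta> * (norm y)\<^sup>2 \<le> f (xs + y)"
      using V(4)[of "xs + y"] by simp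
    moreover obtain s where "s \<in> S" "f (xs + y) = fs s (xs + y)"
      using attained by blast
    ultimately show ?thesis
      by (intro bexI[of _ s]) (auto simp: hs_def)
  qed
  have zero: "hs s 0 = 0" if "s \<in> S" for s
    using assms(7) that by (auto simp: hs_def active_set_def)
  obtain lam :: "nat \<Rightarrow> real" where lam: "\<And>s. s \<in> S \<Longrightarrow> lam s > 0" "sum lam S = 1"
    "(\<Sum>s\<in>S. lam s *\<^sub>R G s 0) = 0"
    using assms(8) by (auto simp: G_def)
  have indep: "affinely_independent_family S (\<lambda>s. G s 0)"
    using assms(9) by (simp add: G_def)
  obtain r C where rC: "r > 0" "C > 0"
    and descent: "\<And>x \<Delta> F. \<lbrakk>norm x < r; 0 < \<Delta>; \<Delta> < norm x; \<And>s. s \<in> S \<Longrightarrow> hs s x \<le> F\<rbrakk>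
           \<Longrightarrow> \<exists>z\<in>cball x \<Delta>. \<forall>s\<in>S. hs s z \<le> F - C * \<Delta>\<^sup>2"
    using uniform_quadratic_descent[OF S(1) deriv zero A growth \<rho>(1) V(3) lam indep] by blast
  have cont: "continuous_on X f" for X
  proof -
    have "continuous_on X (fs s)" if "s \<in> S" for s
      using diff[OF that] differentiable_imp_continuous_within
      by (auto intro!: continuous_at_imp_continuous_on)
    then show ?thesis
      unfolding ext[of f, OF assms(5)] by (intro continuous_on_Max_finite S)
  qed
  have "C \<le> Lambda f 2 x \<Delta>" if x: "x \<in> ball xs r" and \<Delta>: "0 < \<Delta>" "xs \<notin> cball x \<Delta>" for x \<Delta>
  proof -
    have "norm (x - xs) < r" "\<Delta> < norm (x - xs)"
      using x \<Delta> by (auto simp: dist_norm norm_minus_commute)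
    moreover have "hs s (x - xs) \<le> f x - f xs" if "s \<in> S" for s
      using le_f[OF that] by (simp add: hs_def)
    ultimately obtain z where z: "z \<in> cball (x - xs) \<Delta>"
      "\<forall>s\<in>S. hs s z \<le> f x - f xs - C * \<Delta>\<^sup>2"
      using descent \<Delta>(1) by blast
    have "xs + z \<in> cball x \<Delta>"
      using z(1) by (simp add: dist_norm algebra_simps)
    moreover have "f (xs + z) \<le> f x - C * \<Delta>\<^sup>2"
      using attained[of "xs + z"] z(2) by (force simp: hs_def)
    ultimately show ?thesis
      using cont \<Delta>(1) by (intro Lambda_ge)
  qed
  then show ?thesis
    unfolding property_P_def using rC by (intro exI[of _ "ball xs r"] exI[of _ C]) auto
qed

end
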